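(* If $E_0,E_1,\dots$ is an infinite sequence of analytic equivalence relations, $E_i$ on a Polish space $X_i$, each of whose equivalence classes has more than one element, then the product equivalence relation $\prod_iE_i$ on $\prod_iX_i$ (defined by $x\,(\prod_iE_i)\,y\iff\forall i\ x_i\,E_i\,y_i$) is Borel graphable.
   Context: An equivalence relation $E$ on a Polish space $X$ is Borel graphable if there is a Borel graph on $X$ whose connectedness relation ($x,y$ related iff joined by a finite path) equals $E$. *)

theory Defs
  imports "HOL-Analysis.Analysis"
begin

definition polish_space :: "'a topology \<Rightarrow> bool" where
  "polish_space X \<longleftrightarrow> separable_space X \<and> completely_metrizable_space X"

definition borel_sets_of :: "'a topology \<Rightarrow> 'a set set" where
  "borel_sets_of X = sigma_sets (topspace X) {U. openin X U}"

text \<open>A subset of \<open>X\<close> is analytic if it is the image of some Polish space under a continuous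
  map into \<open>X\<close> (the empty set being the image of the empty space). One cannot quantify over types
  inside a formula, so the underlying set of that space is taken to be a set of reals, with an
  arbitrary Polish topology on it. This loses nothing, because a Polish space has at most continuum
  many points; see \<open>analytic_in_continuous_image\<close> below.\<close>

definition analytic_in :: "'a topology \<Rightarrow> 'a set \<Rightarrow> bool" where
  "analytic_in X A \<longleftrightarrow>
     (\<exists>(Y :: real topology) f. polish_space Y \<and> continuous_map Y X f \<and> f ` topspace Y = A)"

definition analytic_equiv :: "'a topology \<Rightarrow> ('a \<times> 'a) set \<Rightarrow> bool" where
  "analytic_equiv X E \<longleftrightarrow> equiv (topspace X) E \<and> analytic_in (prod_topology X X) E"

definition borel_graph :: "'a topology \<Rightarrow> ('a \<times> 'a) set \<Rightarrow> bool" where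
  "borel_graph X G \<longleftrightarrow> G \<in> borel_sets_of (prod_topology X X) \<and> sym G \<and> irrefl G"

text \<open>\<open>G\<^sup>*\<close> is reflexive on the whole type, hence the restriction to the points of \<open>X\<close>.\<close>

definition connectedness_rel :: "'a topology \<Rightarrow> ('a \<times> 'a) set \<Rightarrow> ('a \<times> 'a) set" where
  "connectedness_rel X G = {(x, y). x \<in> topspace X \<and> y \<in> topspace X \<and> (x, y) \<in> G\<^sup>*}"

definition borel_graphable :: "'a topology \<Rightarrow> ('a \<times> 'a) set \<Rightarrow> bool" where
  "borel_graphable X E \<longleftrightarrow> (\<exists>G. borel_graph X G \<and> connectedness_rel X G = E)"

definition product_rel :: "(nat \<Rightarrow> 'a topology) \<Rightarrow> (nat \<Rightarrow> ('a \<times> 'a) set) \<Rightarrow>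
    ((nat \<Rightarrow> 'a) \<times> (nat \<Rightarrow> 'a)) set" where
  "product_rel X E = {(x, y). x \<in> topspace (product_topology X UNIV) \<and>
     y \<in> topspace (product_topology X UNIV) \<and> (\<forall>i. (x i, y i) \<in> E i)}"

lemma polish_space_lepoll_real:
  assumes "polish_space Y"
  shows "topspace Y \<lesssim> (UNIV :: real set)"
proof -
  obtain M d where M: "Metric_space M d" and Y: "Y = Metric_space.mtopology M d"
    using assms unfolding polish_space_def completely_metrizable_space_def by blast
  interpret Metric_space M d by (fact M)
  have top: "topspace Y = M" by (simp add: Y)
  obtain C where C: "countable C" "C \<subseteq> M" "mtopology closure_of C = M"
    using assms unfolding polish_space_def separable_space_def Y by auto
  define code where "code y = {m. \<exists>n k. m = prod_encode (n, k) \<and>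
      d y (from_nat_into C n) < inverse (real (Suc k))}" for y
  have "inj_on code M"
  proof (rule inj_onI, rule ccontr)
    fix y z assume yz: "y \<in> M" "z \<in> M" "code y = code z" "y \<noteq> z"
    then have "d y z / 2 > 0" by simp
    then obtain k where k: "inverse (real (Suc k)) < d y z / 2"
      using reals_Archimedean by blast
    have "y \<in> mtopology closure_of C" using C yz by simp
    moreover have "0 < inverse (real (Suc k))" by simp
    ultimately obtain c where c: "c \<in> C" "c \<in> mball y (inverse (real (Suc k)))"
      unfolding metric_closure_of by blast
    obtain n where n: "from_nat_into C n = c"
      using c(1) C(1) by (metis from_nat_into_surj)
    have dy: "d y c < inverse (real (Suc k))" using c(2) by simp
    then have "prod_encode (n, k) \<in> code y" unfolding code_def using n by auto
    then have "prod_encode (n, k) \<in> code z" using yz by simp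
    then have dz: "d z c < inverse (real (Suc k))" unfolding code_def using n by auto
    have "d y z \<le> d y c + d z c"
      using triangle[of y c z] commute[of c z] yz c(1) C(2) by auto
    then show False using dy dz k by linarith
  qed
  then have "M \<lesssim> (UNIV :: nat set set)" unfolding lepoll_def by blast
  then show ?thesis
    unfolding top by (rule lepoll_trans[OF _ eqpoll_imp_lepoll[OF nat_sets_eqpoll_reals]])
qed

lemma analytic_in_continuous_image:
  fixes Y :: "'b topology" and X :: "'a topology"
  assumes Y: "polish_space Y" and f: "continuous_map Y X f"
  shows "analytic_in X (f ` topspace Y)"
proof -
  obtain g :: "'b \<Rightarrow> real" where g: "inj_on g (topspace Y)"
    using polish_space_lepoll_real[OF Y] unfolding lepoll_def by blast
  define h where "h = inv_into (topspace Y) g"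
  define Z where "Z = pullback_topology (g ` topspace Y) h Y"
  have hg: "h (g y) = y" if "y \<in> topspace Y" for y
    using that g by (simp add: h_def)
  have topZ: "topspace Z = g ` topspace Y"
    unfolding Z_def topspace_pullback_topology using hg by auto
  have contg: "continuous_map Y Z g"
    unfolding Z_def
  proof (rule continuous_map_pullback')
    show "continuous_map Y Y (h \<circ> g)"
      by (rule continuous_map_eq[OF continuous_map_id]) (simp add: hg)
  qed auto
  have conth: "continuous_map Z Y h"
    unfolding Z_def using continuous_map_pullback[of Y Y id "g ` topspace Y" h] by simp
  have "homeomorphic_maps Y Z g h"
    unfolding homeomorphic_maps_def using contg conth topZ hg by auto
  then have "Y homeomorphic_space Z"
    unfolding homeomorphic_space_def by blast
  then have "polish_space Z"
    using Y homeomorphic_separable_space homeomorphic_completely_metrizable_space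
    unfolding polish_space_def by blast
  moreover have "continuous_map Z X (f \<circ> h)"
    using conth f by (rule continuous_map_compose)
  moreover have "(f \<circ> h) ` topspace Z = f ` topspace Y"
    unfolding topZ using hg by force
  ultimately show ?thesis unfolding analytic_in_def by blast
qed

end

theory Submission
  imports Defs
begin

text \<open>A point of an analytic set is certified by a set of naturals, in a Borel way. Join \<open>x\<close> and
  \<open>y\<close> if the set of even (or of odd) coordinates at which they differ encodes, for every coordinate
  \<open>i\<close> with \<open>x\<^sub>i \<noteq> y\<^sub>i\<close>, a certificate of \<open>x\<^sub>i E\<^sub>i y\<^sub>i\<close>. This is a Borel condition. Since classes
  are nontrivial, from \<open>x\<close> one can move to \<open>v\<close> that agrees with \<open>y\<close> on the odd coordinates, choosing
  where to change the even ones so as to encode all certificates needed. In the same way one moves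
  from \<open>v\<close> to \<open>z\<close> that agrees with \<open>y\<close> on the even coordinates. As \<open>v\<close> and \<open>y\<close> agree on the odd
  coordinates, the certificates encoded by \<open>(v, z)\<close> also join \<open>y\<close> to \<open>z\<close>.\<close>

section \<open>Borel certificates for membership in an analytic set\<close>

lemma borel_sets_of_openin: "openin X U \<Longrightarrow> U \<in> borel_sets_of X"
  unfolding borel_sets_of_def by blast

lemma sets_sigma_openin: "sets (sigma (topspace X) {U. openin X U}) = borel_sets_of X"
  unfolding borel_sets_of_def by (rule sets_measure_of) (use openin_subset in blast)

text \<open>The existential quantifier over points of a Polish space is moved into \<open>T\<close>,
  and what remains only quantifies over naturals, hence is Borel. The certificate \<open>S w\<close>
  may vary with the point \<open>w\<close>, because it will be read off from a pair of points; all
  that is asked of it is that each of its bits be Borel.\<close>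

lemma analytic_in_code:
  fixes Z :: "'a topology"
  assumes Z: "metrizable_space Z" and A: "analytic_in Z A"
  obtains R :: "nat set \<Rightarrow> 'a \<Rightarrow> bool" where
    "\<And>z. z \<in> A \<longleftrightarrow> (\<exists>T. R T z)"
    "\<And>(W :: 'b topology) h S. continuous_map W Z h \<Longrightarrow>
       (\<And>n. {w \<in> topspace W. n \<in> S w} \<in> borel_sets_of W) \<Longrightarrow>
       {w \<in> topspace W. R (S w) (h w)} \<in> borel_sets_of W"
proof (cases "A = {}")
  case True
  \<comment> \<open>An empty \<open>A\<close> is the image of an empty space, which has no dense
    sequence to enumerate.\<close>
  show thesis
    by (rule that[of "\<lambda>_ _. False"])
      (use True in \<open>auto simp: borel_sets_of_def intro: sigma_sets.Empty\<close>)
next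
  case False
  obtain Y :: "real topology" and f where Y: "polish_space Y" and f: "continuous_map Y Z f"
    and fA: "f ` topspace Y = A"
    using A unfolding analytic_in_def by blast
  obtain M d where M: "Metric_space M d" and compl: "Metric_space.mcomplete M d"
    and Yd: "Y = Metric_space.mtopology M d"
    using Y unfolding polish_space_def completely_metrizable_space_def by blast
  obtain N e where N: "Metric_space N e" and Ze: "Z = Metric_space.mtopology N e"
    using Z unfolding metrizable_space_def by blast
  interpret Y: Metric_space M d by (fact M)
  interpret Z: Metric_space N e by (fact N)
  obtain C where C: "countable C" "C \<subseteq> M" "Y.mtopology closure_of C = M"
    using Y unfolding polish_space_def separable_space_def Yd by auto
  have fA: "f ` M = A" using fA by (simp add: Yd)
  have fN: "f x \<in> N" if "x \<in> M" for x
    using continuous_map_image_subset_topspace[OF f] that by (auto simp: Yd Ze)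
  have "C \<noteq> {}" using C(3) False fA by auto
  define c where "c = from_nat_into C"
  have cM: "c a \<in> M" for a
    using from_nat_into[OF \<open>C \<noteq> {}\<close>] C(2) unfolding c_def by blast
  define r where "r k = inverse (real (Suc k))" for k
  have r: "r k > 0" for k unfolding r_def by simp
  have r_less: "\<exists>k. r k < \<epsilon>" if "\<epsilon> > 0" for \<epsilon>
    using reals_Archimedean[OF that] unfolding r_def .
  have r_mono: "r k \<le> r l" if "l \<le> k" for k l
    using that unfolding r_def by (simp add: field_simps)
  have dense: "\<exists>a. d (c a) y < r k" if "y \<in> M" for y k
  proof -
    have "y \<in> Y.mtopology closure_of C" using C that by simp
    then obtain x where x: "x \<in> C" "x \<in> Y.mball y (r k)"
      using r[of k] unfolding Y.metric_closure_of by blast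
    obtain a where "c a = x" using x(1) C(1) unfolding c_def by (metis from_nat_into_surj)
    then show ?thesis using x(2) by (auto simp: Y.commute)
  qed
  \<comment> \<open>\<open>(a, k) \<in> T\<close> stands for \<open>d (c a) y < r k\<close>: \<open>T\<close> describes a Cauchy sequence in the dense set, and by
    continuity \<open>f y = z\<close> can be stated without mentioning its limit \<open>y\<close>.\<close>
  define R where "R T z \<longleftrightarrow> z \<in> N \<and> (\<forall>k. \<exists>a. prod_encode (a, k) \<in> T) \<and>
      (\<forall>a k b l. prod_encode (a, k) \<in> T \<longrightarrow> prod_encode (b, l) \<in> T \<longrightarrow> d (c a) (c b) < r k + r l) \<and>
      (\<forall>m. \<exists>K. \<forall>k a. K \<le> k \<longrightarrow> prod_encode (a, k) \<in> T \<longrightarrow> e (f (c a)) z < r m)" for T z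
  \<comment> \<open>By completeness the approximations \<open>c (a k)\<close> converge to some
    \<open>y\<close>. Their images converge to \<open>f y\<close> by continuity and to
    \<open>z\<close> by the last clause of \<open>R\<close>, so \<open>z = f y\<close>.\<close>
  have sound: "z \<in> A" if "R T z" for T z
  proof -
    have zN: "z \<in> N" using that unfolding R_def by blast
    have "\<forall>k. \<exists>a. prod_encode (a, k) \<in> T" using that unfolding R_def by blast
    then obtain a where a: "\<And>k. prod_encode (a k, k) \<in> T" by metis
    have "Y.MCauchy (\<lambda>k. c (a k))"
      unfolding Y.MCauchy_def
    proof (intro conjI allI impI)
      show "range (\<lambda>k. c (a k)) \<subseteq> M" using cM by blast
      fix \<epsilon> :: real assume "\<epsilon> > 0"
      then obtain K where K: "r K < \<epsilon> / 2" using r_less[of "\<epsilon> / 2"] by auto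
      show "\<exists>K. \<forall>k l. K \<le> k \<longrightarrow> K \<le> l \<longrightarrow> d (c (a k)) (c (a l)) < \<epsilon>"
      proof (intro exI allI impI)
        fix k l assume kl: "K \<le> k" "K \<le> l"
        have "d (c (a k)) (c (a l)) < r k + r l" using that a unfolding R_def by blast
        then show "d (c (a k)) (c (a l)) < \<epsilon>" using K r_mono[OF kl(1)] r_mono[OF kl(2)] by linarith
      qed
    qed
    then obtain y where y: "limitin Y.mtopology (\<lambda>k. c (a k)) y sequentially"
      using compl unfolding Y.mcomplete_def by blast
    then have yM: "y \<in> M" using Y.limitin_mspace by blast
    have "limitin Z.mtopology (f \<circ> (\<lambda>k. c (a k))) (f y) sequentially"
      using continuous_map_limit[OF f[unfolded Yd Ze] y] .
    moreover have "limitin Z.mtopology (f \<circ> (\<lambda>k. c (a k))) z sequentially"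
      unfolding Z.limitin_metric eventually_sequentially
    proof (intro conjI allI impI zN)
      fix \<epsilon> :: real assume "\<epsilon> > 0"
      then obtain m where m: "r m < \<epsilon>" using r_less by auto
      obtain K where "\<And>k b. K \<le> k \<Longrightarrow> prod_encode (b, k) \<in> T \<Longrightarrow> e (f (c b)) z < r m"
        using \<open>R T z\<close> unfolding R_def by blast
      then have "\<forall>k\<ge>K. e (f (c (a k))) z < \<epsilon>" using a m by (meson less_trans)
      then show "\<exists>K. \<forall>k\<ge>K. (f \<circ> (\<lambda>k. c (a k))) k \<in> N \<and> e ((f \<circ> (\<lambda>k. c (a k))) k) z < \<epsilon>"
        using fN cM by auto
    qed
    ultimately have "f y = z"
      using Z.limitin_metric_unique trivial_limit_sequentially by blast
    then show ?thesis using fA yM by blast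
  qed
  have complete: "\<exists>T. R T z" if "z \<in> A" for z
  proof -
    obtain y where y: "y \<in> M" "z = f y" using \<open>z \<in> A\<close> fA by blast
    \<comment> \<open>All true approximations of \<open>y\<close> are collected. The clauses of
      \<open>R\<close> then follow from density, the triangle inequality and continuity of
      \<open>f\<close> at \<open>y\<close>, respectively.\<close>
    define T where "T = {n. \<exists>a k. n = prod_encode (a, k) \<and> d (c a) y < r k}"
    have T: "prod_encode (a, k) \<in> T \<longleftrightarrow> d (c a) y < r k" for a k
      unfolding T_def by auto
    have "d (c a) (c b) < r k + r l" if "d (c a) y < r k" "d (c b) y < r l" for a b k l
      using Y.triangle[OF cM[of a] y(1) cM[of b]] that Y.commute[of y "c b"] by linarith
    moreover have "\<exists>K. \<forall>k a. K \<le> k \<longrightarrow> d (c a) y < r k \<longrightarrow> e (f (c a)) z < r m" for m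
    proof -
      have "openin Y.mtopology {x \<in> topspace Y.mtopology. f x \<in> Z.mball z (r m)}"
        using openin_continuous_map_preimage[OF f[unfolded Yd Ze]] Z.openin_mball by blast
      moreover have "y \<in> {x \<in> topspace Y.mtopology. f x \<in> Z.mball z (r m)}"
        using y r fN by auto
      ultimately obtain \<delta> where \<delta>: "\<delta> > 0"
        "Y.mball y \<delta> \<subseteq> {x \<in> topspace Y.mtopology. f x \<in> Z.mball z (r m)}"
        unfolding Y.openin_mtopology by blast
      obtain K where K: "r K < \<delta>" using r_less \<delta>(1) by blast
      show ?thesis
      proof (intro exI allI impI)
        fix k a assume "K \<le> k" "d (c a) y < r k"
        then have "d y (c a) < \<delta>" using K r_mono[of K k] by (simp add: Y.commute)
        then have "c a \<in> Y.mball y \<delta>" using y cM by simp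
        then have "f (c a) \<in> Z.mball z (r m)" using \<delta>(2) by blast
        then show "e (f (c a)) z < r m" by (simp add: Z.commute)
      qed
    qed
    ultimately have "R T z"
      unfolding R_def T using dense[OF y(1)] fN y by blast
    then show ?thesis by blast
  qed
  show thesis
  proof (rule that[of R])
    show "z \<in> A \<longleftrightarrow> (\<exists>T. R T z)" for z using sound complete by blast
    fix W :: "'b topology" and h and S :: "'b \<Rightarrow> nat set"
    assume h: "continuous_map W Z h" and S: "\<And>n. {w \<in> topspace W. n \<in> S w} \<in> borel_sets_of W"
    define B where "B = sigma (topspace W) {U. openin W U}"
    have B: "sets B = borel_sets_of W" "space B = topspace W"
      unfolding B_def by (rule sets_sigma_openin) (rule space_measure_of, use openin_subset in blast)
    have hN: "h w \<in> N" if "w \<in> topspace W" for w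
      using continuous_map_image_subset_topspace[OF h] that by (auto simp: Ze)
    have [measurable]: "Measurable.pred B (\<lambda>w. n \<in> S w)" for n
      using S unfolding pred_def B by blast
    have [measurable]: "Measurable.pred B (\<lambda>w. e (f (c a)) (h w) < r m)" for a m
    proof -
      have "openin W {w \<in> topspace W. h w \<in> Z.mball (f (c a)) (r m)}"
        using openin_continuous_map_preimage[OF h[unfolded Ze] Z.openin_mball] .
      moreover have "{w \<in> topspace W. h w \<in> Z.mball (f (c a)) (r m)} =
          {w \<in> topspace W. e (f (c a)) (h w) < r m}"
        using hN fN cM by auto
      ultimately show ?thesis unfolding pred_def B by (simp add: borel_sets_of_openin)
    qed
    \<comment> \<open>Only countable quantifiers occur. The atoms are bits of \<open>S w\<close>,
      conditions independent of \<open>w\<close>, and distances from fixed points to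
      \<open>h w\<close>. The clause \<open>z \<in> N\<close> is left out since it holds for every
      \<open>h w\<close>.\<close>
    have "Measurable.pred B (\<lambda>w. (\<forall>k. \<exists>a. prod_encode (a, k) \<in> S w) \<and>
      (\<forall>a k b l. prod_encode (a, k) \<in> S w \<longrightarrow> prod_encode (b, l) \<in> S w \<longrightarrow> d (c a) (c b) < r k + r l) \<and>
      (\<forall>m. \<exists>K. \<forall>k a. K \<le> k \<longrightarrow> prod_encode (a, k) \<in> S w \<longrightarrow> e (f (c a)) (h w) < r m))"
      by measurable
    then have "{w \<in> topspace W. (\<forall>k. \<exists>a. prod_encode (a, k) \<in> S w) \<and>
      (\<forall>a k b l. prod_encode (a, k) \<in> S w \<longrightarrow> prod_encode (b, l) \<in> S w \<longrightarrow> d (c a) (c b) < r k + r l) \<and>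
      (\<forall>m. \<exists>K. \<forall>k a. K \<le> k \<longrightarrow> prod_encode (a, k) \<in> S w \<longrightarrow> e (f (c a)) (h w) < r m)}
      \<in> borel_sets_of W"
      unfolding pred_def B .
    moreover have "{w \<in> topspace W. R (S w) (h w)} = {w \<in> topspace W. (\<forall>k. \<exists>a. prod_encode (a, k) \<in> S w) \<and>
      (\<forall>a k b l. prod_encode (a, k) \<in> S w \<longrightarrow> prod_encode (b, l) \<in> S w \<longrightarrow> d (c a) (c b) < r k + r l) \<and>
      (\<forall>m. \<exists>K. \<forall>k a. K \<le> k \<longrightarrow> prod_encode (a, k) \<in> S w \<longrightarrow> e (f (c a)) (h w) < r m)}"
      unfolding R_def using hN by blast
    ultimately show "{w \<in> topspace W. R (S w) (h w)} \<in> borel_sets_of W" by (simp only:)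
  qed
qed

section \<open>Writing certificates into the differences between two points\<close>

definition code_coord :: "nat \<Rightarrow> nat \<Rightarrow> nat \<Rightarrow> nat" where
  "code_coord b i n = 2 * prod_encode (i, n) + b"

text \<open>The coordinates of parity \<open>b\<close> are indexed by pairs \<open>(i, n)\<close>,
  so each \<open>i\<close> owns infinitely many of them, one for each bit \<open>n\<close> of its
  certificate. A bit is 1 where the two points differ.\<close>

definition diff_code :: "nat \<Rightarrow> (nat \<Rightarrow> 'a) \<Rightarrow> (nat \<Rightarrow> 'a) \<Rightarrow> nat \<Rightarrow> nat set" where
  "diff_code b x y i = {n. x (code_coord b i n) \<noteq> y (code_coord b i n)}"

text \<open>The equality alternative lets a coordinate stay put in order to write a 0 bit, whatever
  certificate was prepared for it.\<close>

definition certified ::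
    "(nat \<Rightarrow> nat set \<Rightarrow> 'a \<times> 'a \<Rightarrow> bool) \<Rightarrow> nat \<Rightarrow> (nat \<Rightarrow> 'a) \<Rightarrow> (nat \<Rightarrow> 'a) \<Rightarrow> bool" where
  "certified R b x y \<longleftrightarrow> (\<forall>i. x i = y i \<or> R i (diff_code b x y i) (x i, y i))"

lemma code_coord_mod: "b < 2 \<Longrightarrow> code_coord b i n mod 2 = b"
  unfolding code_coord_def by simp

lemma code_coord_div: "b < 2 \<Longrightarrow> prod_decode (code_coord b i n div 2) = (i, n)"
  unfolding code_coord_def by simp

lemma certified_rel:
  assumes "certified R b x y" and "\<And>i T p. R i T p \<Longrightarrow> p \<in> E i" and "\<And>i. (x i, x i) \<in> E i"
  shows "(x i, y i) \<in> E i"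
  using assms unfolding certified_def by metis

text \<open>The code in \<open>v\<close> must certify the very changes that write it. To avoid
  circularity, a target \<open>t\<close> with certificates \<open>T\<close> is fixed first. Then
  \<open>v\<close> is obtained from \<open>t\<close> by resetting some coordinates to their value in
  \<open>x\<close>, and those need no certificate.\<close>

lemma certified_step:
  assumes b: "b < 2"
    and R: "\<And>i p. p \<in> E i \<Longrightarrow> \<exists>T. R i T p"
    and nontriv: "\<And>i. \<exists>a. a \<noteq> x i \<and> (x i, a) \<in> E i"
    and xy: "\<And>i. (x i, y i) \<in> E i"
  obtains v where "certified R b x v" "\<And>i. i mod 2 \<noteq> b \<Longrightarrow> v i = y i"
proof -
  obtain a where a: "\<And>i. a i \<noteq> x i" "\<And>i. (x i, a i) \<in> E i" using nontriv by metis
  define t where "t i = (if i mod 2 = b then a i else y i)" for i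
  have "(x i, t i) \<in> E i" for i using a xy unfolding t_def by simp
  then have "\<forall>i. \<exists>T. R i T (x i, t i)" using R by blast
  then obtain T where T: "\<And>i. R i (T i) (x i, t i)" by metis
  \<comment> \<open>An index \<open>i\<close> of parity \<open>b\<close> carries bit
    \<open>n\<close> of \<open>T j\<close>. It moves to \<open>a i \<noteq> x i\<close> for a 1 and
    stays for a 0, so the difference set decodes to exactly \<open>T j\<close>.\<close>
  define v where "v i = (if i mod 2 = b \<and> (case prod_decode (i div 2) of (j, n) \<Rightarrow> n \<notin> T j)
    then x i else t i)" for i
  have "diff_code b x v j = T j" for j
    unfolding diff_code_def v_def t_def
    using a(1) by (auto simp: code_coord_mod[OF b] code_coord_div[OF b] dest: not_sym)
  then have "certified R b x v" unfolding certified_def using T by (auto simp: v_def)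
  moreover have "v i = y i" if "i mod 2 \<noteq> b" for i using that unfolding v_def t_def by simp
  ultimately show thesis using that by blast
qed

text \<open>On parity \<open>b\<close> the points \<open>x\<close> and \<open>y\<close> agree, so
  the same code is read and the same pairs are certified. On the other parity \<open>y\<close> and
  \<open>z\<close> agree and nothing has to be certified.\<close>

lemma certified_cong:
  assumes "certified R b x z" and b: "b < 2"
    and "\<And>i. i mod 2 = b \<Longrightarrow> x i = y i" and "\<And>i. i mod 2 \<noteq> b \<Longrightarrow> z i = y i"
  shows "certified R b y z"
proof -
  have "diff_code b x z = diff_code b y z"
    unfolding diff_code_def using assms(3) code_coord_mod[OF b] by simp
  then show ?thesis using assms unfolding certified_def by metis
qed

theorem theorem5p5:
  fixes X :: "nat \<Rightarrow> 'a topology" and E :: "nat \<Rightarrow> ('a \<times> 'a) set"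
  assumes "\<And>i. polish_space (X i)"
    and "\<And>i. analytic_equiv (X i) (E i)"
    and "\<And>i C. C \<in> topspace (X i) // E i \<Longrightarrow> \<exists>a\<in>C. \<exists>b\<in>C. a \<noteq> b"
  shows "borel_graphable (product_topology X UNIV) (product_rel X E)"
proof -

  \<comment> \<open>Choice of certificates and definition of the graph\<close>
  let ?P = "product_topology X UNIV"
  let ?W = "prod_topology ?P ?P"
  have metr: "metrizable_space (X i)" for i
    using assms(1) completely_metrizable_imp_metrizable_space unfolding polish_space_def by blast
  have eqv: "equiv (topspace (X i)) (E i)" for i
    using assms(2) unfolding analytic_equiv_def by blast
  have EX: "p \<in> topspace (X i) \<and> q \<in> topspace (X i)" if "(p, q) \<in> E i" for i p q
    using equiv_type[OF eqv] that by blast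
  have Erefl: "(p, p) \<in> E i" if "p \<in> topspace (X i)" for i p
    using eqv that unfolding equiv_def refl_on_def by blast
  have Esym: "(q, p) \<in> E i" if "(p, q) \<in> E i" for i p q
    using eqv that unfolding equiv_def sym_def by blast
  have Etrans: "(p, s) \<in> E i" if "(p, q) \<in> E i" "(q, s) \<in> E i" for i p q s
    using eqv that unfolding equiv_def trans_def by blast
  have nontriv: "\<exists>a. a \<noteq> p \<and> (p, a) \<in> E i" if "p \<in> topspace (X i)" for i p
    using assms(3)[OF quotientI[OF that]] by (metis Image_singleton_iff)
  have topP: "x \<in> topspace ?P \<longleftrightarrow> (\<forall>i. x i \<in> topspace (X i))" for x by auto
  \<comment> \<open>Both properties are bundled so that a single use of choice selects
    \<open>R i\<close> for all \<open>i\<close>.\<close>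
  define codes :: "nat \<Rightarrow> (nat set \<Rightarrow> 'a \<times> 'a \<Rightarrow> bool) \<Rightarrow> bool"
    where "codes i R \<longleftrightarrow> (\<forall>p. p \<in> E i \<longleftrightarrow> (\<exists>T. R T p)) \<and>
      (\<forall>h S. continuous_map ?W (prod_topology (X i) (X i)) h \<longrightarrow>
        (\<forall>n. {w \<in> topspace ?W. n \<in> S w} \<in> borel_sets_of ?W) \<longrightarrow>
        {w \<in> topspace ?W. R (S w) (h w)} \<in> borel_sets_of ?W)" for i R
  have "\<exists>R. codes i R" for i
  proof -
    have "metrizable_space (prod_topology (X i) (X i))"
      using metr by (simp add: metrizable_space_prod_topology)
    moreover have "analytic_in (prod_topology (X i) (X i)) (E i)"
      using assms(2) unfolding analytic_equiv_def by blast
    ultimately show ?thesis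
    proof (rule analytic_in_code)
      fix R :: "nat set \<Rightarrow> 'a \<times> 'a \<Rightarrow> bool"
      assume R: "\<And>p. p \<in> E i \<longleftrightarrow> (\<exists>T. R T p)"
        and R_borel: "\<And>(W :: ((nat \<Rightarrow> 'a) \<times> (nat \<Rightarrow> 'a)) topology) h S.
         continuous_map W (prod_topology (X i) (X i)) h \<Longrightarrow>
         (\<And>n. {w \<in> topspace W. n \<in> S w} \<in> borel_sets_of W) \<Longrightarrow>
         {w \<in> topspace W. R (S w) (h w)} \<in> borel_sets_of W"
      show ?thesis unfolding codes_def by (intro exI[of _ R] conjI allI impI R R_borel) blast+
    qed
  qed
  then have "\<exists>R. \<forall>i. codes i (R i)" by (rule choice[OF allI])
  then obtain R where codes: "\<And>i. codes i (R i)" by blast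
  have R: "\<And>i p. p \<in> E i \<longleftrightarrow> (\<exists>T. R i T p)" for i p
    using codes unfolding codes_def by blast
  have R_borel: "{w \<in> topspace ?W. R i (S w) (h w)} \<in> borel_sets_of ?W"
    if "continuous_map ?W (prod_topology (X i) (X i)) h"
      "\<And>n. {w \<in> topspace ?W. n \<in> S w} \<in> borel_sets_of ?W" for i h S
    using codes[of i, unfolded codes_def, THEN conjunct2, rule_format, OF that] .
  define D where "D x y \<longleftrightarrow> (\<exists>b<2. certified R b x y)" for x y
  \<comment> \<open>\<open>D\<close> need not be symmetric: a certificate for
    \<open>(x i, y i)\<close> need not be one for \<open>(y i, x i)\<close>.\<close>
  define G where "G = {(x, y). x \<in> topspace ?P \<and> y \<in> topspace ?P \<and> x \<noteq> y \<and> (D x y \<or> D y x)}"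

  have certE: "(u i, v i) \<in> E i" if "certified R b u v" "u \<in> topspace ?P" for b u v i
    by (rule certified_rel[OF that(1)]) (use R Erefl that(2) topP in blast)+

  \<comment> \<open>Borelness of the graph\<close>
  define B where "B = sigma (topspace ?W) {U. openin ?W U}"
  have B: "sets B = borel_sets_of ?W" "space B = topspace ?W"
    unfolding B_def by (rule sets_sigma_openin) (rule space_measure_of, use openin_subset in blast)
  have proj: "continuous_map ?W (X i) (\<lambda>w. fst w i)" "continuous_map ?W (X i) (\<lambda>w. snd w i)" for i
    using continuous_map_compose[OF continuous_map_fst continuous_map_product_projection[of i UNIV X]]
      continuous_map_compose[OF continuous_map_snd continuous_map_product_projection[of i UNIV X]]
    by (simp_all add: o_def)
  \<comment> \<open>Each \<open>X i\<close> is Hausdorff, so equality at one coordinate is a closed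
    condition. These inequalities are the bits of the difference codes.\<close>
  have neq [measurable]: "Measurable.pred B (\<lambda>w. fst w i \<noteq> snd w i)" for i
  proof -
    have "closedin ?W {w \<in> topspace ?W. fst w i = snd w i}"
      using closedin_continuous_maps_eq[OF metrizable_imp_Hausdorff_space[OF metr] proj] .
    then have "openin ?W (topspace ?W - {w \<in> topspace ?W. fst w i = snd w i})"
      by (rule openin_diff[OF openin_topspace])
    moreover have "topspace ?W - {w \<in> topspace ?W. fst w i = snd w i} =
        {w \<in> topspace ?W. fst w i \<noteq> snd w i}" by blast
    ultimately have "openin ?W {w \<in> topspace ?W. fst w i \<noteq> snd w i}" by (simp only:)
    then show ?thesis unfolding pred_def B by (rule borel_sets_of_openin)
  qed
  have [measurable]: "Measurable.pred B (\<lambda>w. fst w i = snd w i)"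
    "Measurable.pred B (\<lambda>w. snd w i = fst w i)" for i
    using pred_intros_logic(2)[OF neq[of i]] by (simp_all add: eq_commute)
  have [measurable]: "Measurable.pred B (\<lambda>w. R i (diff_code b (fst w) (snd w) i) (fst w i, snd w i))"
    "Measurable.pred B (\<lambda>w. R i (diff_code b (snd w) (fst w) i) (snd w i, fst w i))" for i b
  proof -
    have diff: "{w \<in> topspace ?W. n \<in> diff_code b (fst w) (snd w) i} \<in> borel_sets_of ?W"
      "{w \<in> topspace ?W. n \<in> diff_code b (snd w) (fst w) i} \<in> borel_sets_of ?W" for n
      using neq[of "code_coord b i n"] unfolding pred_def B diff_code_def by (simp_all add: eq_commute)
    show "Measurable.pred B (\<lambda>w. R i (diff_code b (fst w) (snd w) i) (fst w i, snd w i))"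
      unfolding pred_def B by (rule R_borel[OF continuous_map_pairedI[OF proj] diff(1)])
    show "Measurable.pred B (\<lambda>w. R i (diff_code b (snd w) (fst w) i) (snd w i, fst w i))"
      unfolding pred_def B by (rule R_borel[OF continuous_map_pairedI[OF proj(2) proj(1)] diff(2)])
  qed
  have [measurable]: "Measurable.pred B (\<lambda>w. certified R b (fst w) (snd w))"
    "Measurable.pred B (\<lambda>w. certified R b (snd w) (fst w))" for b
    unfolding certified_def by measurable
  have "Measurable.pred B (\<lambda>w. (\<exists>i. fst w i \<noteq> snd w i) \<and>
      ((\<exists>b<2. certified R b (fst w) (snd w)) \<or> (\<exists>b<2. certified R b (snd w) (fst w))))"
    (is "Measurable.pred B ?Q")
    by measurable
  moreover have "G = {w \<in> space B. ?Q w}"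
    unfolding G_def D_def B(2) topspace_prod_topology fun_eq_iff by fastforce
  ultimately have "G \<in> borel_sets_of ?W" unfolding pred_def B(1) by simp
  moreover have "sym G" "irrefl G" unfolding G_def sym_def irrefl_def by auto
  ultimately have "borel_graph ?P G" unfolding borel_graph_def by blast

  \<comment> \<open>Connectedness in the graph\<close>
  moreover have "connectedness_rel ?P G = product_rel X E"
  proof (intro equalityI subsetI)
    fix w assume "w \<in> connectedness_rel ?P G"
    then obtain x y where w: "w = (x, y)" and x: "x \<in> topspace ?P" and y: "y \<in> topspace ?P"
      and xy: "(x, y) \<in> G\<^sup>*"
      unfolding connectedness_rel_def by blast
    from xy have "\<forall>i. (x i, y i) \<in> E i"
    proof (induction rule: rtrancl_induct)
      case base
      then show ?case using Erefl x unfolding topP by blast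
    next
      case (step y z)
      then have "(y i, z i) \<in> E i" for i using certE Esym unfolding G_def D_def by blast
      then show ?case using step.IH Etrans by blast
    qed
    then show "w \<in> product_rel X E" unfolding product_rel_def w using x y by blast
  next
    fix w assume "w \<in> product_rel X E"
    then obtain x y where w: "w = (x, y)" and x: "x \<in> topspace ?P" and y: "y \<in> topspace ?P"
      and xy: "\<And>i. (x i, y i) \<in> E i"
      unfolding product_rel_def by blast
    \<comment> \<open>Stated for \<open>G\<^sup>*\<close> because \<open>u\<close> and
      \<open>v\<close> may coincide, and \<open>G\<close> has no loops.\<close>
    have edge: "(u, v) \<in> G\<^sup>* \<and> (v, u) \<in> G\<^sup>*"
      if "certified R b u v" "b < 2" "u \<in> topspace ?P" "v \<in> topspace ?P" for b u v
      using that unfolding G_def D_def by (cases "u = v") (auto intro!: r_into_rtrancl)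
    have step: thesis if "b < 2" "u \<in> topspace ?P" "\<And>i. (u i, y i) \<in> E i"
      "\<And>v. certified R b u v \<Longrightarrow> (\<And>i. i mod 2 \<noteq> b \<Longrightarrow> v i = y i) \<Longrightarrow> thesis" for b u thesis
    proof (rule certified_step[of b E R u y])
      show "\<exists>a. a \<noteq> u i \<and> (u i, a) \<in> E i" for i using that(2) nontriv topP by blast
    qed (use that R in blast)+
    obtain v where v: "certified R 0 x v" "\<And>i. i mod 2 \<noteq> 0 \<Longrightarrow> v i = y i"
      using step[OF _ x xy, of 0] by auto
    have vE: "(x i, v i) \<in> E i" for i using certE[OF v(1) x] .
    have vP: "v \<in> topspace ?P" using vE EX unfolding topP by blast
    have vy: "(v i, y i) \<in> E i" for i using Etrans[OF Esym[OF vE] xy] .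
    obtain z where z: "certified R 1 v z" "\<And>i. i mod 2 \<noteq> 1 \<Longrightarrow> z i = y i"
      using step[OF _ vP vy, of 1] by auto
    have zP: "z \<in> topspace ?P" using certE[OF z(1) vP] EX unfolding topP by blast
    have "certified R 1 y z"
      by (rule certified_cong[OF z(1)]) (use v(2) z(2) in auto)
    \<comment> \<open>The path is \<open>x\<close>, \<open>v\<close>, \<open>z\<close>,
      \<open>y\<close>; its last edge is certified from \<open>y\<close> to \<open>z\<close> and
      traversed backwards.\<close>
    then have "(x, v) \<in> G\<^sup>*" "(v, z) \<in> G\<^sup>*" "(z, y) \<in> G\<^sup>*"
      using edge[OF v(1) _ x vP] edge[OF z(1) _ vP zP] edge[OF _ _ y zP, of 1] by simp_all
    then have "(x, y) \<in> G\<^sup>*" by (meson rtrancl_trans)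
    then show "w \<in> connectedness_rel ?P G" unfolding connectedness_rel_def w using x y by blast
  qed
  ultimately show ?thesis unfolding borel_graphable_def by blast
qed

end
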